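(* There exists a Cantor set $E\subset[0,1]$ composed of nonnormal numbers (that is, every $x\in E$ is not normal to base $2$) such that: (1) for all $x\in E$, $\overline{\{2^n x \ (\mathrm{mod}\ 1): n\geq 1\}}=[0,1]$ and $\overline{\{3^n x \ (\mathrm{mod}\ 1): n\geq 1\}}=[0,1]$; (2) $\dim_{H}E=1$.
   Context: $\dim_H$ denotes Hausdorff dimension and the bar denotes topological closure in $[0,1]$. For an integer $b\ge 2$, write the $b$-ary expansion of a real number $x$ as $x=\lfloor x\rfloor+\sum_{k\ge1}a_k b^{-k}$, with digits $a_k\in\{0,1,\dots,b-1\}$ and infinitely many $a_k$ not equal to $b-1$. For a block $D_k=d_1\cdots d_k$ of digits from $\{0,\dots,b-1\}$, let $A_b(D_k,N,x)=\mathrm{Card}\{j: 0\le j\le N-k,\ a_{j+1}=d_1,\dots,a_{j+k}=d_k\}$. The number $x$ is normal to base $b$ if $\lim_{N\to\infty}A_b(D_k,N,x)/N=b^{-k}$ for every $k\ge1$ and every block $D_k$ of $k$ digits from $\{0,\dots,b-1\}$. *)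

theory Defs
  imports "HOL-Analysis.Analysis"
begin

text \<open>Digit sequences are indexed from 0: \<open>a k\<close> is the coefficient of \<open>b^(-(k+1))\<close>.\<close>

definition base_expansion :: "nat \<Rightarrow> real \<Rightarrow> (nat \<Rightarrow> nat) \<Rightarrow> bool" where
  "base_expansion b x a \<longleftrightarrow>
     (\<forall>k. a k < b) \<and>
     infinite {k. a k \<noteq> b - 1} \<and>
     (\<lambda>k. real (a k) / real b ^ Suc k) sums (x - of_int \<lfloor>x\<rfloor>)"

definition base_digits :: "nat \<Rightarrow> real \<Rightarrow> nat \<Rightarrow> nat" where
  "base_digits b x = (THE a. base_expansion b x a)"

lemma floor_mult_base:
  fixes y :: real
  assumes "b \<ge> 2"
  shows "\<lfloor>real b * y\<rfloor> = int b * \<lfloor>y\<rfloor> + \<lfloor>real b * y\<rfloor> mod int b"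
proof -
  have "\<lfloor>y\<rfloor> = \<lfloor>(real b * y) / of_int (int b)\<rfloor>" using assms by simp
  also have "\<dots> = \<lfloor>real b * y\<rfloor> div int b" by (rule floor_divide_real_eq_div) simp
  finally show ?thesis by simp
qed

lemma base_expansion_floor_digits:
  assumes b: "b \<ge> 2"
  shows "base_expansion b x (\<lambda>k. nat (\<lfloor>real b ^ Suc k * x\<rfloor> mod int b))"
proof -
  define d where "d = (\<lambda>k. nat (\<lfloor>real b ^ Suc k * x\<rfloor> mod int b))"
  define F where "F = (\<lambda>n. \<lfloor>real b ^ n * x\<rfloor>)"
  have rec: "F (Suc n) = int b * F n + int (d n)" for n
    using floor_mult_base[OF b, of "real b ^ n * x"] b
    by (simp add: F_def d_def mult.assoc)
  have d_less: "d k < b" for k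
  proof -
    have "\<lfloor>real b ^ Suc k * x\<rfloor> mod int b < int b" using b by simp
    then show ?thesis using b unfolding d_def by (metis of_nat_0_less_iff nat_less_iff pos_mod_sign
      zless_nat_eq_int_zless zero_less_numeral order_less_le_trans)
  qed
  have psum: "(\<Sum>k<n. real (d k) / real b ^ Suc k) = of_int (F n) / real b ^ n - of_int \<lfloor>x\<rfloor>" for n
  proof (induction n)
    case 0
    then show ?case by (simp add: F_def)
  next
    case (Suc n)
    then show ?case using b by (simp add: rec add_divide_distrib)
  qed
  have lim: "(\<lambda>n. of_int (F n) / real b ^ n) \<longlonglongrightarrow> x"
  proof (rule tendsto_sandwich[where f = "\<lambda>n. x - (1 / real b) ^ n" and h = "\<lambda>n. x"])
    have pos: "real b ^ n > 0" for n using b by simp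
    show "\<forall>\<^sub>F n in sequentially. x - (1 / real b) ^ n \<le> of_int (F n) / real b ^ n"
    proof (intro always_eventually allI)
      fix n
      have "real b ^ n * x - 1 \<le> of_int (F n)" unfolding F_def by linarith
      then have "(real b ^ n * x - 1) / real b ^ n \<le> of_int (F n) / real b ^ n"
        using pos[of n] by (intro divide_right_mono) auto
      then show "x - (1 / real b) ^ n \<le> of_int (F n) / real b ^ n"
        using b by (simp add: diff_divide_distrib power_divide split: if_splits)
    qed
    show "\<forall>\<^sub>F n in sequentially. of_int (F n) / real b ^ n \<le> x"
    proof (intro always_eventually allI)
      fix n
      have "of_int (F n) \<le> real b ^ n * x" unfolding F_def by linarith
      then show "of_int (F n) / real b ^ n \<le> x" using pos[of n] by (simp add: field_simps)
    qed
    have "(\<lambda>n. (1 / real b) ^ n) \<longlonglongrightarrow> 0" using b by (intro LIMSEQ_power_zero) simp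
    then show "(\<lambda>n. x - (1 / real b) ^ n) \<longlonglongrightarrow> x" using tendsto_diff[OF tendsto_const] by fastforce
  qed simp
  have inf: "infinite {k. d k \<noteq> b - 1}"
  proof
    assume "finite {k. d k \<noteq> b - 1}"
    then obtain n where n: "\<And>k. k \<ge> n \<Longrightarrow> d k = b - 1"
      by (metis (mono_tags, lifting) finite_nat_set_iff_bounded mem_Collect_eq not_le)
    have eq: "F (n + m) + 1 = int b ^ m * (F n + 1)" for m
    proof (induction m)
      case (Suc m)
      have "F (n + Suc m) + 1 = int b * (F (n + m) + 1)"
        using rec[of "n + m"] n[of "n + m"] b by (simp add: algebra_simps of_nat_diff)
      then show ?case using Suc by simp
    qed simp
    have "of_int (F n) + 1 - real b ^ n * x > 0" unfolding F_def by linarith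
    then obtain m where m: "(1 / real b) ^ m < of_int (F n) + 1 - real b ^ n * x"
      using real_arch_pow_inv[of "of_int (F n) + 1 - real b ^ n * x" "1 / real b"] b by auto
    have "of_int (F (n + m)) \<le> real b ^ (n + m) * x" unfolding F_def by linarith
    then have "of_int (int b ^ m * (F n + 1)) - 1 \<le> real b ^ (n + m) * x"
      using eq[of m] by linarith
    then have "real b ^ m * (of_int (F n) + 1 - real b ^ n * x) \<le> 1"
      by (simp add: algebra_simps power_add)
    then show False using m b by (simp add: field_simps power_divide)
  qed
  have "(\<lambda>k. real (d k) / real b ^ Suc k) sums (x - of_int \<lfloor>x\<rfloor>)"
    unfolding sums_def psum by (intro tendsto_diff lim tendsto_const)
  then have "base_expansion b x d" unfolding base_expansion_def using d_less inf by blast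
  then show ?thesis unfolding d_def .
qed

lemma base_expansion_unique:
  assumes b: "b \<ge> 2" and a: "base_expansion b x a"
  shows "a = (\<lambda>k. nat (\<lfloor>real b ^ Suc k * x\<rfloor> mod int b))"
proof
  fix n
  define t where "t = (\<lambda>k. real (a k) / real b ^ Suc k)"
  define P where "P = (\<lambda>n. \<Sum>k<n. int (a k) * int b ^ (n - Suc k))"
  have less: "a k < b" for k using a by (simp add: base_expansion_def)
  have sums: "t sums (x - of_int \<lfloor>x\<rfloor>)" using a by (simp add: base_expansion_def t_def)
  have P_Suc: "P (Suc n) = int b * P n + int (a n)" for n
  proof -
    have "(\<Sum>k<n. int (a k) * int b ^ (n - k)) = (\<Sum>k<n. int b * (int (a k) * int b ^ (n - Suc k)))"
      by (intro sum.cong refl) (simp add: Suc_diff_Suc flip: power_Suc)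
    then show ?thesis by (simp add: P_def sum_distrib_left)
  qed
  have P_sum: "of_int (P n) = real b ^ n * (\<Sum>k<n. t k)" for n
  proof (induction n)
    case 0
    then show ?case by (simp add: P_def)
  next
    case (Suc n)
    then show ?case using b by (simp add: P_Suc t_def algebra_simps)
  qed
  have flr: "\<lfloor>real b ^ n * x\<rfloor> = int b ^ n * \<lfloor>x\<rfloor> + P n" for n
  proof -
    have tail: "(\<lambda>k. t (k + n)) sums (x - of_int \<lfloor>x\<rfloor> - (\<Sum>k<n. t k))"
      using sums sums_iff_shift'[of t n] by simp
    have nonneg: "t k \<ge> 0" for k by (simp add: t_def)
    have lo: "0 \<le> x - of_int \<lfloor>x\<rfloor> - (\<Sum>k<n. t k)"
      using sums_le[OF _ sums_zero tail] nonneg by simp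
    have geo: "(\<lambda>k. (real b - 1) / real b ^ Suc (k + n)) sums (1 / real b ^ n)"
    proof -
      have "(\<lambda>k. (1 / real b) ^ k) sums (1 / (1 - 1 / real b))"
        using b by (intro geometric_sums) simp
      from sums_mult[OF this, of "(real b - 1) / real b ^ Suc n"]
      moreover have "(real b - 1) / real b ^ Suc n * (1 / real b) ^ k = (real b - 1) / real b ^ Suc (k + n)" for k
        by (simp add: power_add power_divide mult_ac)
      moreover have "(real b - 1) / real b ^ Suc n * (1 / (1 - 1 / real b)) = 1 / real b ^ n"
      proof -
        have "1 / (1 - 1 / real b) = real b / (real b - 1)" using b by (simp add: field_simps)
        then show ?thesis using b by simp
      qed
      ultimately show ?thesis by (simp only:)
    qed
    have diff: "(\<lambda>k. (real b - 1) / real b ^ Suc (k + n) - t (k + n)) sums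
        (1 / real b ^ n - (x - of_int \<lfloor>x\<rfloor> - (\<Sum>k<n. t k)))"
      using sums_diff[OF geo tail] .
    have ge: "(real b - 1) / real b ^ Suc (k + n) - t (k + n) \<ge> 0" for k
    proof -
      have "real (a (k + n)) \<le> real b - 1" using less[of "k + n"] by linarith
      then show ?thesis using b by (simp add: t_def divide_right_mono)
    qed
    obtain j where j: "j \<ge> n" "a j \<noteq> b - 1"
      using a unfolding base_expansion_def infinite_nat_iff_unbounded_le by auto
    have "real (a j) < real b - 1" using less[of j] j by linarith
    then have gt: "(real b - 1) / real b ^ Suc ((j - n) + n) - t ((j - n) + n) > 0"
      using b j by (simp add: t_def divide_strict_right_mono)
    have hi: "x - of_int \<lfloor>x\<rfloor> - (\<Sum>k<n. t k) < 1 / real b ^ n"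
      using suminf_pos2[OF sums_summable[OF diff] ge gt] sums_unique[OF diff] by simp
    have pos: "real b ^ n > 0" using b by simp
    have "0 \<le> real b ^ n * (x - of_int \<lfloor>x\<rfloor> - (\<Sum>k<n. t k))"
      using lo pos by (intro mult_nonneg_nonneg) auto
    moreover have "real b ^ n * (x - of_int \<lfloor>x\<rfloor> - (\<Sum>k<n. t k)) < 1"
      using hi pos by (simp add: pos_less_divide_eq mult.commute)
    ultimately show ?thesis using P_sum[of n]
      by (intro floor_unique) (simp_all add: algebra_simps)
  qed
  have "\<lfloor>real b ^ Suc n * x\<rfloor> = int b * (int b ^ n * \<lfloor>x\<rfloor> + P n) + int (a n)"
    using flr[of "Suc n"] by (simp add: P_Suc algebra_simps)
  then have "\<lfloor>real b ^ Suc n * x\<rfloor> mod int b = int (a n)"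
    using less[of n] by (metis mod_mult_self4 mod_less zmod_int)
  then show "a n = nat (\<lfloor>real b ^ Suc n * x\<rfloor> mod int b)" by simp
qed

lemma base_digits_eq_floor:
  assumes "b \<ge> 2"
  shows "base_digits b x k = nat (\<lfloor>real b ^ Suc k * x\<rfloor> mod int b)"
  unfolding base_digits_def
  using the_equality[of "base_expansion b x", OF base_expansion_floor_digits[OF assms]
      base_expansion_unique[OF assms]] by simp

definition block_count :: "nat \<Rightarrow> nat list \<Rightarrow> nat \<Rightarrow> real \<Rightarrow> nat" where
  "block_count b D N x =
     card {j. j + length D \<le> N \<and> (\<forall>i<length D. base_digits b x (j + i) = D ! i)}"

definition normal_number :: "nat \<Rightarrow> real \<Rightarrow> bool" where
  "normal_number b x \<longleftrightarrow>
     (\<forall>D. D \<noteq> [] \<and> set D \<subseteq> {..<b} \<longrightarrow>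
        (\<lambda>N. real (block_count b D N x) / real N) \<longlonglongrightarrow> 1 / real b ^ length D)"

definition cantor_set :: "'a::metric_space set \<Rightarrow> bool" where
  "cantor_set A \<longleftrightarrow>
     A \<noteq> {} \<and> compact A \<and> (\<forall>x\<in>A. x islimpt A) \<and>
     (\<forall>x\<in>A. connected_component_set A x = {x})"

text \<open>\<open>diam U ^ s\<close> with the conventions \<open>diam {} ^ s = 0\<close> and \<open>0 ^ 0 = 1\<close> for nonempty \<open>U\<close>
  (note that \<open>0 powr 0 = 0\<close>).\<close>

definition diam_power :: "real \<Rightarrow> 'a::metric_space set \<Rightarrow> ennreal" where
  "diam_power s U =
     (if U = {} then 0 else if s = 0 then 1 else ennreal (diameter U powr s))"

text \<open>Boundedness of the covering sets is required explicitly because \<^const>\<open>diameter\<close> is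
  real-valued and meaningless on unbounded sets.\<close>

definition hausdorff_premeasure :: "real \<Rightarrow> real \<Rightarrow> 'a::metric_space set \<Rightarrow> ennreal" where
  "hausdorff_premeasure \<delta> s A =
     (INF U \<in> {U :: nat \<Rightarrow> 'a set. A \<subseteq> (\<Union>i. U i) \<and> (\<forall>i. bounded (U i) \<and> diameter (U i) \<le> \<delta>)}.
        \<Sum>i. diam_power s (U i))"

definition hausdorff_measure :: "real \<Rightarrow> 'a::metric_space set \<Rightarrow> ennreal" where
  "hausdorff_measure s A = (SUP \<delta> \<in> {0<..}. hausdorff_premeasure \<delta> s A)"

definition hausdorff_dim :: "'a::metric_space set \<Rightarrow> ennreal" where
  "hausdorff_dim A = Inf {ennreal s | s. s \<ge> 0 \<and> hausdorff_measure s A = 0}"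

end

theory Submission
  imports Defs "HOL-Library.Nat_Bijection" "HOL-Real_Asymp.Real_Asymp"
begin

text \<open>
  Binary digits are read off a free parameter \<open>\<omega>\<close>, with two modifications. On a set of positions of
  density zero (short blocks at powers of two) the digits are instead used to steer \<open>b\<^sup>j x\<close> modulo 1
  into a prescribed dyadic interval; every base \<open>b \<ge> 2\<close> and every interval is served by some block, so
  all orbits are dense. Elsewhere every \<open>m\<close>-th digit is 0, so the word \<open>1\<^sup>m\<close> meets a steering block
  whenever it occurs: it has frequency zero and the number is not normal. The spacing \<open>m\<close> is determined
  by the first 1 in \<open>\<omega>\<close>, hence it is unbounded over the set, yet the digits depend continuously
  on \<open>\<omega>\<close>: before the first 1 there is nothing to suppress. So the set of all these numbers is
  compact; it is totally disconnected since a rational number has a finite orbit.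

  For the dimension, fix \<open>m\<close> and feed the digits of \<open>u \<in> [0,1)\<close> into the free positions. As at least
  \<open>s n - C\<close> of the first \<open>n\<close> positions are free, with \<open>s\<close> close to 1 for large \<open>m\<close>, the \<open>u\<close> whose
  point lies in a set of diameter \<open>2\<^sup>-\<^sup>n\<close> fill at most five intervals of length \<open>2\<^sup>C\<^sup>-\<^sup>s\<^sup>n\<close>; countable
  subadditivity of Lebesgue measure on \<open>[0,1)\<close> then bounds the \<open>s\<close>-dimensional sums from below.
\<close>

section \<open>The steering blocks\<close>

definition start :: "nat \<Rightarrow> nat" where "start k = 2 ^ (k + 4)"
text \<open>The digits spent in \<open>exists_hit\<close>: \<open>k + 1\<close> for the base,
  \<open>k + 1\<close> for the length of the interval including rounding, and one so that the
  stretched interval covers a whole unit cell.\<close>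

definition len :: "nat \<Rightarrow> nat" where "len k = 2 * k + 3"
definition block :: "nat \<Rightarrow> nat set" where "block k = {start k..<start k + len k}"
definition forced :: "nat set" where "forced = (\<Union>k. block k)"
definition block_of :: "nat \<Rightarrow> nat" where "block_of n = (THE k. n \<in> block k)"

text \<open>Block \<open>k\<close> encodes a base \<open>c + 2\<close> and the dyadic interval with left end \<open>t / 2\<^sup>h\<close>; \<open>q\<close> stands for the
  dyadic interval of order \<open>M\<close> with left end \<open>q / 2\<^sup>M\<close>. Intervals ending at 1 are left out because
  \<open>frac\<close> jumps there.\<close>

definition hits :: "nat \<Rightarrow> nat \<Rightarrow> nat \<Rightarrow> bool" where
  "hits k M q = (case prod_decode k of (c, d) \<Rightarrow> case prod_decode d of (t, h) \<Rightarrow>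
     t + 1 < 2 ^ h \<longrightarrow> (\<forall>x. real q / 2 ^ M \<le> x \<and> x \<le> (real q + 1) / 2 ^ M \<longrightarrow>
       (\<exists>j\<ge>1. real t / 2 ^ h \<le> frac (real (c + 2) ^ j * x) \<and>
          frac (real (c + 2) ^ j * x) \<le> (real t + 1) / 2 ^ h)))"

text \<open>The case \<open>m = 0\<close> separates the blocks; growing \<open>m\<close> gives
  arbitrarily long windows between them.\<close>

lemma gap_between_blocks: "k \<ge> m \<Longrightarrow> start k + len k + m \<le> start (Suc k)"
proof -
  assume "k \<ge> m"
  have "3 * k + 3 \<le> 16 * 2 ^ k" by (induction k) auto
  then show ?thesis using \<open>k \<ge> m\<close> by (simp add: start_def len_def power_add)
qed

lemma start_mono: "i \<le> j \<Longrightarrow> start i \<le> start j"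
  by (simp add: start_def)

lemma block_end_le_start: "i < j \<Longrightarrow> start i + len i \<le> start j"
  using gap_between_blocks[of 0 i] start_mono[of "Suc i" j] by simp

lemma block_of_eq: "n \<in> block k \<Longrightarrow> block_of n = k"
  unfolding block_of_def
proof (rule the_equality)
  fix j assume "n \<in> block k" "n \<in> block j"
  then show "j = k"
    using block_end_le_start[of j k] block_end_le_start[of k j]
    by (cases j k rule: linorder_cases) (auto simp: block_def)
qed

text \<open>About log n blocks start below \<open>n\<close>, each of length O(log n), so the count
  is O((log n)^2).\<close>

lemma card_forced_le:
  assumes "\<epsilon> > 0"
  shows "\<exists>C\<ge>0. \<forall>n. real (card (forced \<inter> {..<n})) \<le> \<epsilon> * real n + C"
proof -
  have "eventually (\<lambda>K::nat. real K * (2 * real K + 1) \<le> \<epsilon> * 2 ^ (K + 3)) sequentially"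
    using assms by real_asymp
  then obtain K0 where K0: "\<And>K. K \<ge> K0 \<Longrightarrow> real K * (2 * real K + 1) \<le> \<epsilon> * 2 ^ (K + 3)"
    by (auto simp: eventually_sequentially)
  show ?thesis
  proof (intro exI conjI allI)
    show "real K0 * (2 * real K0 + 1) \<ge> 0" by simp
    fix n
    \<comment> \<open>The number of blocks that start before \<open>n\<close>.\<close>
    define K where "K = (LEAST k. n \<le> start k)"
    have ex: "n \<le> start n"
      using less_exp[of "n + 4"] unfolding start_def by linarith
    have K1: "n \<le> start K" unfolding K_def by (rule LeastI[of _ n]) (rule ex)
    have K2: "start k < n" if "k < K" for k
      using not_less_Least[of k "\<lambda>k. n \<le> start k"] that unfolding K_def by auto
    have "forced \<inter> {..<n} \<subseteq> (\<Union>k<K. block k)"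
    proof
      fix i assume "i \<in> forced \<inter> {..<n}"
      then obtain k where k: "i \<in> block k" "i < n" by (auto simp: forced_def)
      then have "start k < start K" using K1 by (auto simp: block_def)
      then have "k < K" using start_mono[of K k] by (meson leD leI)
      then show "i \<in> (\<Union>k<K. block k)" using k by auto
    qed
    then have "card (forced \<inter> {..<n}) \<le> card (\<Union>k<K. block k)"
      by (intro card_mono) (auto simp: block_def)
    also have "\<dots> \<le> (\<Sum>k<K. card (block k))" by (intro card_UN_le) simp
    also have "\<dots> \<le> (\<Sum>k<K. 2 * K + 1)"
      by (intro sum_mono) (auto simp: block_def len_def)
    finally have le: "card (forced \<inter> {..<n}) \<le> K * (2 * K + 1)" by simp
    show "real (card (forced \<inter> {..<n})) \<le> \<epsilon> * real n + real K0 * (2 * real K0 + 1)"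
    \<comment> \<open>For large \<open>K\<close>, minimality gives \<open>start (K - 1) < n\<close>,
      which dominates the quadratic bound in \<open>K\<close>; small \<open>K\<close> are absorbed
      by the constant.\<close>
    proof (cases "K \<ge> K0 \<and> K > 0")
      case True
      then have "2 ^ (K + 3) < n" using K2[of "K - 1"] by (simp add: start_def add.commute)
      then have "(2::real) ^ (K + 3) \<le> real n"
        by (metis less_imp_le of_nat_le_iff of_nat_numeral of_nat_power)
      then have "\<epsilon> * 2 ^ (K + 3) \<le> \<epsilon> * real n" using assms by simp
      moreover have "real (card (forced \<inter> {..<n})) \<le> real K * (2 * real K + 1)"
        using of_nat_mono[OF le, where 'a = real] by (simp add: algebra_simps)
      ultimately show ?thesis using K0[of K] True
        by (meson add_increasing2 of_nat_0_le_iff mult_nonneg_nonneg order_trans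
          zero_le_numeral zero_le_one add_nonneg_nonneg)
    next
      case False
      then have "K \<le> K0" by auto
      then have "K * (2 * K + 1) \<le> K0 * (2 * K0 + 1)" by (intro mult_mono) auto
      then have "real (card (forced \<inter> {..<n})) \<le> real (K0 * (2 * K0 + 1))"
        using le by linarith
      moreover have "\<epsilon> * real n \<ge> 0" using assms by simp
      ultimately show ?thesis by (simp add: algebra_simps)
    qed
  qed
qed

text \<open>The window ends exactly where a late block begins and fits into the gap before
  it.\<close>

lemma exists_unforced_window:
  "\<exists>i\<ge>N. {i..<i + m} \<inter> forced = {}"
proof -
  define k where "k = N + m"
  let ?i = "start (Suc k) - m"
  have g: "start k + len k + m \<le> start (Suc k)" by (rule gap_between_blocks) (simp add: k_def)
  have "N \<le> start k" using less_exp[of "k + 4"] unfolding start_def k_def by linarith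
  then have "N \<le> ?i" using g by simp
  moreover have "j \<notin> block l" if "j \<in> {?i..<?i + m}" for j l
  proof (cases "l \<le> k")
    case True
    then have "start l + len l \<le> start k + len k"
      using start_mono[of l k] by (simp add: len_def)
    then show ?thesis using that g by (auto simp: block_def)
  next
    case False
    then show ?thesis using that g start_mono[of "Suc k" l] by (auto simp: block_def)
  qed
  ultimately show ?thesis unfolding forced_def by blast
qed

text \<open>Multiplication by a suitable power of the base stretches the dyadic interval of
  \<open>p\<close> over a whole unit cell. The part of it sent into the target interval is long
  enough to contain a dyadic interval of order \<open>n + len k\<close>.\<close>

lemma exists_hit:
  "\<exists>q. q div 2 ^ len k = p \<and> hits k (n + len k) q"
proof -
  obtain c d where d: "prod_decode k = (c, d)" by fastforce
  obtain t h where th: "prod_decode d = (t, h)" by fastforce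
  have k: "k = prod_encode (c, prod_encode (t, h))"
    by (metis d th prod_decode_inverse)
  \<comment> \<open>A pair code is at least as large as its components, so \<open>k\<close> bounds
    both base and precision.\<close>
  have ck: "c \<le> k" using le_prod_encode_1 k by blast
  have hk: "h \<le> k" using le_prod_encode_2 k order_trans by metis
  show ?thesis
  proof (cases "t + 1 < 2 ^ h")
    case False
    then show ?thesis by (intro exI[of _ "p * 2 ^ len k"]) (auto simp: hits_def d th)
  next
    case th1: True
    define b where "b = c + 2"
    define M where "M = n + len k"
    have b2: "b \<ge> 2" by (simp add: b_def)
    \<comment> \<open>The lower bound on \<open>b ^ j\<close> makes the stretched interval at least
      2 long; minimality keeps the preimage of the target from being too short.\<close>
    define j where "j = (LEAST j. 2 ^ (n + 1) \<le> b ^ j)"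
    have j1: "2 ^ (n + 1) \<le> b ^ j" unfolding j_def
      by (rule LeastI[of _ "n + 1"]) (rule power_mono[OF b2], simp)
    have "j \<noteq> 0" using j1 one_less_power[of "2::nat" "n + 1"] by (intro notI) simp
    then obtain i where i: "j = Suc i" by (cases j) auto
    have "b ^ i < 2 ^ (n + 1)" using not_less_Least[of i "\<lambda>j. 2 ^ (n + 1) \<le> b ^ j"] i
      unfolding j_def by auto
    then have "b ^ j \<le> b * 2 ^ (n + 1)" using i by simp
    also have "b \<le> 2 ^ (k + 1)"
    proof -
      have "k + 2 \<le> 2 ^ (k + 1)" by (induction k) auto
      then show ?thesis using ck by (simp add: b_def)
    qed
    finally have "b ^ j \<le> 2 ^ (k + 1) * 2 ^ (n + 1)" by simp
    then have "b ^ j * 2 ^ (h + 1) \<le> 2 ^ (k + 1) * 2 ^ (n + 1) * 2 ^ (k + 1)"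
      using hk by (intro mult_mono) auto
    also have "\<dots> = 2 ^ M"
    proof -
      have "M = (k + 1) + (n + 1) + (k + 1)" by (simp add: M_def len_def)
      then show ?thesis by (simp only: power_add)
    qed
    finally have "real (b ^ j * 2 ^ (h + 1)) \<le> real (2 ^ M)" by (rule of_nat_mono)
    then have fine: "real b ^ j * 2 ^ h * 2 \<le> 2 ^ M" by simp
    define B where "B = real b ^ j"
    have B: "B \<ge> 2 ^ (n + 1)"
      using of_nat_mono[OF j1, where 'a = real] by (simp add: B_def)
    have B0: "B > 0" using B by (meson less_le_trans zero_less_numeral zero_less_power)
    \<comment> \<open>The first integer in the stretched interval; length 2 leaves room for the
      whole cell from \<open>z\<close> to \<open>z + 1\<close>.\<close>
    define z where "z = \<lceil>real p * B / 2 ^ n\<rceil>"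
    have z1: "real p / 2 ^ n \<le> of_int z / B"
      using B0 le_of_int_ceiling[of "real p * B / 2 ^ n"] by (simp add: z_def field_simps)
    have z2: "(of_int z + 1) / B \<le> (real p + 1) / 2 ^ n"
    proof -
      have "of_int z < real p * B / 2 ^ n + 1" unfolding z_def by linarith
      then have "of_int z + 1 \<le> real p * B / 2 ^ n + 2" by simp
      also have "\<dots> \<le> real p * B / 2 ^ n + B / 2 ^ n"
        using B by (simp add: field_simps)
      finally show ?thesis using B0 by (simp add: field_simps)
    qed
    define lo where "lo = (of_int z + real t / 2 ^ h) / B"
    define hi where "hi = (of_int z + (real t + 1) / 2 ^ h) / B"
    have t1: "(real t + 1) / 2 ^ h < 1"
    proof -
      have "real (t + 1) < real (2 ^ h)" using th1 by (simp only: of_nat_less_iff)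
      then show ?thesis by simp
    qed
    have lo: "real p / 2 ^ n \<le> lo"
      using z1 B0 by (auto simp: lo_def add_divide_distrib intro: add_increasing2)
    have hi: "hi \<le> (real p + 1) / 2 ^ n"
      using z2 t1 B0 unfolding hi_def
      by (meson add_left_mono divide_right_mono less_imp_le order_trans)
    \<comment> \<open>Two grid steps of order \<open>M\<close> guarantee a complete grid cell
      between \<open>lo\<close> and \<open>hi\<close>, namely the one starting at the first grid
      point from \<open>lo\<close> on.\<close>
    have width: "lo + 2 / 2 ^ M \<le> hi"
    proof -
      have "2 / 2 ^ M \<le> 1 / (2 ^ h * B)"
        using fine B0 by (simp add: B_def field_simps)
      moreover have "hi - lo = 1 / (2 ^ h * B)"
        using B0 by (simp add: hi_def lo_def field_simps)
      ultimately show ?thesis by simp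
    qed
    have lo0: "lo \<ge> 0" using lo by (meson divide_nonneg_nonneg of_nat_0_le_iff order_trans
      zero_le_numeral zero_le_power)
    define q where "q = nat \<lceil>lo * 2 ^ M\<rceil>"
    have rq: "real q = of_int \<lceil>lo * 2 ^ M\<rceil>" using lo0 by (simp add: q_def)
    have q1: "lo \<le> real q / 2 ^ M"
      using le_of_int_ceiling[of "lo * 2 ^ M"] rq by (simp add: field_simps)
    have q2: "(real q + 1) / 2 ^ M \<le> hi"
    proof -
      have "real q + 1 \<le> lo * 2 ^ M + 2" using rq by linarith
      then have "(real q + 1) / 2 ^ M \<le> lo + 2 / 2 ^ M"
        by (simp add: pos_divide_le_eq distrib_right)
      then show ?thesis using width by simp
    qed
    have "q div 2 ^ len k = p"
    proof (rule div_nat_eqI)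
      have "real p / 2 ^ n \<le> real q / 2 ^ M" using q1 lo by linarith
      then have "2 ^ n * real (2 ^ len k * p) \<le> 2 ^ n * real q"
        by (simp add: M_def power_add field_simps)
      then have "real (2 ^ len k * p) \<le> real q"
        by (rule mult_left_le_imp_le) simp
      then show "2 ^ len k * p \<le> q" by (simp only: of_nat_le_iff)
      have "(real q + 1) / 2 ^ M \<le> (real p + 1) / 2 ^ n" using q2 hi by linarith
      then have "2 ^ n * real (q + 1) \<le> 2 ^ n * real (2 ^ len k * Suc p)"
        by (simp add: M_def power_add field_simps)
      then have "real (q + 1) \<le> real (2 ^ len k * Suc p)"
        by (rule mult_left_le_imp_le) simp
      then have "q + 1 \<le> 2 ^ len k * Suc p" by (simp only: of_nat_le_iff)
      then show "q < 2 ^ len k * Suc p" by simp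
    qed
    moreover have "hits k M q"
      unfolding hits_def d th prod.case
    proof (intro impI allI)
      fix x assume x: "real q / 2 ^ M \<le> x \<and> x \<le> (real q + 1) / 2 ^ M"
      have "lo \<le> x" "x \<le> hi" using x q1 q2 by linarith+
      then have *: "of_int z + real t / 2 ^ h \<le> B * x" "B * x \<le> of_int z + (real t + 1) / 2 ^ h"
        using B0 by (simp_all add: lo_def hi_def field_simps)
      have "real t / 2 ^ h \<ge> 0" by simp
      then have "\<lfloor>B * x\<rfloor> = z" using * t1 by (intro floor_unique) linarith+
      then have "real t / 2 ^ h \<le> frac (B * x)" "frac (B * x) \<le> (real t + 1) / 2 ^ h"
        using * by (simp_all add: frac_def)
      then show "\<exists>j\<ge>1. real t / 2 ^ h \<le> frac (real (c + 2) ^ j * x) \<and>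
          frac (real (c + 2) ^ j * x) \<le> (real t + 1) / 2 ^ h"
        using i unfolding B_def b_def by (intro exI[of _ j]) auto
    qed
    ultimately show ?thesis unfolding M_def by blast
  qed
qed

section \<open>The points of the Cantor set\<close>

definition target :: "nat \<Rightarrow> nat \<Rightarrow> nat" where
  "target k p = (SOME q. q div 2 ^ len k = p \<and> hits k (start k + len k) q)"

lemma target_div: "target k p div 2 ^ len k = p"
  and hits_target: "hits k (start k + len k) (target k p)"
  using someI_ex[OF exists_hit[of k p "start k"]] by (simp_all add: target_def)

text \<open>For \<open>\<omega> = (\<lambda>_. False)\<close> the \<open>LEAST\<close> is an unspecified number, which is harmless: all free digits
  are 0 then, whatever the spacing.\<close>

definition spacing :: "(nat \<Rightarrow> bool) \<Rightarrow> nat" where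
  "spacing \<omega> = (LEAST r. \<omega> r) + 2"

text \<open>\<open>prefix \<omega> n\<close> is the number with the first \<open>n\<close> binary digits; inside a block the value of
  \<open>prefix\<close> at the start of the block is recovered by division.\<close>

fun prefix :: "(nat \<Rightarrow> bool) \<Rightarrow> nat \<Rightarrow> nat" where
  "prefix \<omega> 0 = 0"
| "prefix \<omega> (Suc n) =
     (if n \<in> forced then
        target (block_of n) (prefix \<omega> n div 2 ^ (n - start (block_of n)))
          div 2 ^ (start (block_of n) + len (block_of n) - Suc n)
      else 2 * prefix \<omega> n + of_bool (\<omega> n \<and> \<not> spacing \<omega> dvd n))"

definition digit :: "(nat \<Rightarrow> bool) \<Rightarrow> nat \<Rightarrow> nat" where
  "digit \<omega> n = prefix \<omega> (Suc n) mod 2"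

definition point :: "(nat \<Rightarrow> bool) \<Rightarrow> real" where
  "point \<omega> = (\<Sum>n. real (digit \<omega> n) / 2 ^ Suc n)"

text \<open>Since the target extends the prefix at the start of the block, shifting back by
  \<open>i\<close> recovers that prefix, and the recursion consults the same target throughout the
  block.\<close>

lemma prefix_in_block:
  "i \<le> len k \<Longrightarrow> prefix \<omega> (start k + i) = target k (prefix \<omega> (start k)) div 2 ^ (len k - i)"
proof (induction i)
  case 0
  then show ?case by (simp add: target_div)
next
  case (Suc i)
  have mem: "start k + i \<in> block k" using Suc.prems by (simp add: block_def)
  then have f: "start k + i \<in> forced" by (auto simp: forced_def)
  have "2 ^ (len k - i) * 2 ^ i = (2::nat) ^ len k"
    using Suc.prems by (simp flip: power_add)
  then have "prefix \<omega> (start k + i) div 2 ^ i = prefix \<omega> (start k)"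
    using Suc by (simp add: target_div flip: div_mult2_eq)
  then show ?case using f block_of_eq[OF mem] by simp
qed

text \<open>Makes the prefixes nested, so that \<open>digit\<close> really lists the binary digits
  they are built from.\<close>

lemma prefix_Suc_div: "prefix \<omega> (Suc n) div 2 = prefix \<omega> n"
proof (cases "n \<in> forced")
  case False
  then show ?thesis by simp
next
  case True
  then obtain k where k: "n \<in> block k" by (auto simp: forced_def)
  define i where "i = n - start k"
  have n: "n = start k + i" "i < len k" using k by (auto simp: i_def block_def)
  have "2 ^ (len k - Suc i) * 2 = (2::nat) ^ (len k - i)"
    using n(2) by (metis Suc_diff_Suc power_Suc2)
  then show ?thesis
    using prefix_in_block[of i k \<omega>] prefix_in_block[of "Suc i" k \<omega>] n
    by (simp flip: div_mult2_eq del: prefix.simps)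
qed

lemma prefix_Suc: "prefix \<omega> (Suc n) = 2 * prefix \<omega> n + digit \<omega> n"
  unfolding digit_def using prefix_Suc_div[of \<omega> n] by (metis mult_div_mod_eq)

lemma digit_less: "digit \<omega> n < 2"
  by (simp add: digit_def)

lemma digit_unforced:
  "n \<notin> forced \<Longrightarrow> digit \<omega> n = of_bool (\<omega> n \<and> \<not> spacing \<omega> dvd n)"
  by (simp add: digit_def)

lemma prefix_sum: "(\<Sum>i<n. real (digit \<omega> i) / 2 ^ Suc i) = real (prefix \<omega> n) / 2 ^ n"
proof (induction n)
  case (Suc n)
  then show ?case unfolding prefix_Suc by (simp add: field_simps)
qed simp

lemma point_sums: "(\<lambda>n. real (digit \<omega> n) / 2 ^ Suc n) sums point \<omega>"
  unfolding point_def
proof (rule summable_sums, rule summable_comparison_test'[where g = "\<lambda>n. (1/2) ^ Suc n"])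
  show "summable (\<lambda>n. (1/2::real) ^ Suc n)"
    by (subst summable_Suc_iff) (intro summable_geometric, simp)
  show "norm (real (digit \<omega> n) / 2 ^ Suc n) \<le> (1/2) ^ Suc n" for n
    using digit_less[of \<omega> n] by (simp add: power_divide divide_right_mono)
qed

lemma point_limit: "(\<lambda>n. real (prefix \<omega> n) / 2 ^ n) \<longlonglongrightarrow> point \<omega>"
  using point_sums[of \<omega>] unfolding sums_def prefix_sum .

lemma point_ge: "real (prefix \<omega> n) / 2 ^ n \<le> point \<omega>"
proof (rule incseq_le[OF _ point_limit])
  show "incseq (\<lambda>n. real (prefix \<omega> n) / 2 ^ n)"
    by (rule incseq_SucI) (simp add: prefix_Suc field_simps del: prefix.simps)
qed

lemma point_le: "point \<omega> \<le> (real (prefix \<omega> n) + 1) / 2 ^ n"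
proof -
  have "decseq (\<lambda>n. (real (prefix \<omega> n) + 1) / 2 ^ n)"
  proof (rule decseq_SucI)
    fix n
    have "real (digit \<omega> n) \<le> 1" using digit_less[of \<omega> n] by simp
    then show "(real (prefix \<omega> (Suc n)) + 1) / 2 ^ Suc n \<le> (real (prefix \<omega> n) + 1) / 2 ^ n"
      by (simp add: prefix_Suc field_simps del: prefix.simps)
  qed
  moreover have "(\<lambda>n. (real (prefix \<omega> n) + 1) / 2 ^ n) \<longlonglongrightarrow> point \<omega>"
  proof -
    have "(\<lambda>n. (1/2::real) ^ n) \<longlonglongrightarrow> 0" by (rule LIMSEQ_power_zero) simp
    from tendsto_add[OF point_limit this] show ?thesis
      by (simp add: add_divide_distrib power_divide)
  qed
  ultimately show ?thesis by (rule decseq_ge)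
qed

lemma spacing_ge_2: "spacing \<omega> \<ge> 2"
  by (simp add: spacing_def)

lemma zero_unforced: "0 \<notin> forced"
  by (auto simp: forced_def block_def start_def)

text \<open>Position 0 is unforced and a multiple of every spacing, so the first digit is 0.\<close>

lemma point_range: "0 \<le> point \<omega>" "point \<omega> < 1"
  using point_ge[of \<omega> 0] point_le[of \<omega> 1] zero_unforced by simp_all

lemma exists_multiple_in_window:
  fixes i m :: nat
  assumes "m > 0"
  obtains l where "l \<in> {i..<i + m}" "m dvd l"
proof
  show "m dvd (i + m - 1) div m * m" by simp
  have "(i + m - 1) div m * m + (i + m - 1) mod m = i + m - 1" by simp
  moreover have "(i + m - 1) mod m < m" using assms by simp
  ultimately show "(i + m - 1) div m * m \<in> {i..<i + m}" using assms
    unfolding atLeastLessThan_iff by linarith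
qed

text \<open>Multiples of the spacing in unforced windows give infinitely many digits 0, so this is
  the admissible expansion and uniqueness applies.\<close>

lemma base_digits_point: "base_digits 2 (point \<omega>) n = digit \<omega> n"
proof -
  have "infinite {k. digit \<omega> k \<noteq> 2 - 1}"
    unfolding infinite_nat_iff_unbounded_le
  proof
    fix N
    obtain i where i: "i \<ge> N" "{i..<i + spacing \<omega>} \<inter> forced = {}"
      using exists_unforced_window by blast
    obtain l where l: "l \<in> {i..<i + spacing \<omega>}" "spacing \<omega> dvd l"
      using exists_multiple_in_window[of "spacing \<omega>" i] spacing_ge_2[of \<omega>] by auto
    then have "digit \<omega> l = 0" using i by (subst digit_unforced) auto
    then show "\<exists>n\<ge>N. n \<in> {k. digit \<omega> k \<noteq> 2 - 1}" using i l
      by (intro exI[of _ l]) auto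
  qed
  moreover have "\<lfloor>point \<omega>\<rfloor> = 0" using point_range[of \<omega>] by (simp add: floor_eq_iff)
  ultimately have "base_expansion 2 (point \<omega>) (digit \<omega>)"
    using point_sums[of \<omega>] digit_less by (auto simp: base_expansion_def)
  then show ?thesis
    using base_expansion_unique[of 2 "point \<omega>" "digit \<omega>"] base_digits_eq_floor[of 2 "point \<omega>" n]
    by auto
qed

section \<open>Nonnormality and dense orbits\<close>

text \<open>A run of \<open>m\<close> ones covers a multiple of \<open>m\<close>, which must be
  forced. Hence at most \<open>m\<close> runs belong to each forced position, and these have density
  zero.\<close>

lemma point_not_normal: "\<not> normal_number 2 (point \<omega>)"
proof
  assume "normal_number 2 (point \<omega>)"
  define m where "m = spacing \<omega>"
  have m: "m > 0" using spacing_ge_2[of \<omega>] by (simp add: m_def)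
  let ?D = "replicate m (1::nat)"
  have lim: "(\<lambda>N. real (block_count 2 ?D N (point \<omega>)) / real N) \<longlonglongrightarrow> 1 / 2 ^ m"
    using \<open>normal_number 2 (point \<omega>)\<close>[unfolded normal_number_def, rule_format, of ?D] m by simp
  \<comment> \<open>Chosen so that \<open>m * \<epsilon>\<close> is half of the limit
    \<open>1 / 2 ^ m\<close>.\<close>
  define \<epsilon> :: real where "\<epsilon> = 1 / (2 ^ m * 2 * real m)"
  have e: "\<epsilon> > 0" using m by (simp add: \<epsilon>_def)
  then obtain C where C: "\<And>n. real (card (forced \<inter> {..<n})) \<le> \<epsilon> * real n + C"
    using card_forced_le by blast
  have count: "block_count 2 ?D N (point \<omega>) \<le> card (forced \<inter> {..<N}) * m" for N
  proof -
    \<comment> \<open>A run is recovered from a forced position in it and the offset of that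
      position.\<close>
    have "{j. j + length ?D \<le> N \<and> (\<forall>i<length ?D. base_digits 2 (point \<omega>) (j + i) = ?D ! i)}
        \<subseteq> (\<lambda>(l, i). l - i) ` ((forced \<inter> {..<N}) \<times> {..<m})"
    proof safe
      fix j assume j: "j + length ?D \<le> N"
        "\<forall>i<length ?D. base_digits 2 (point \<omega>) (j + i) = ?D ! i"
      obtain l where l: "l \<in> {j..<j + m}" "m dvd l"
        using exists_multiple_in_window[OF m] by blast
      have "digit \<omega> l = 1" using j(2)[rule_format, of "l - j"] l by (auto simp: base_digits_point)
      then have "l \<in> forced" using l digit_unforced[of l \<omega>] by (auto simp: m_def)
      then show "j \<in> (\<lambda>(l, i). l - i) ` ((forced \<inter> {..<N}) \<times> {..<m})"
        using l j(1) by (intro image_eqI[of _ _ "(l, l - j)"]) auto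
    qed
    from surj_card_le[OF _ this] show ?thesis by (simp add: block_count_def card_cartesian_product)
  qed
  have "1 / 2 ^ m \<le> real m * \<epsilon>"
  proof (rule LIMSEQ_le[OF lim])
    show "(\<lambda>N. real m * \<epsilon> + real m * C / real N) \<longlonglongrightarrow> real m * \<epsilon>" by real_asymp
    show "\<exists>N0. \<forall>N\<ge>N0. real (block_count 2 ?D N (point \<omega>)) / real N
        \<le> real m * \<epsilon> + real m * C / real N"
    proof (intro exI[of _ 1] allI impI)
      fix N :: nat assume "1 \<le> N"
      have "real (block_count 2 ?D N (point \<omega>)) \<le> real (card (forced \<inter> {..<N})) * real m"
        using of_nat_mono[OF count[of N], where 'a = real] by simp
      also have "\<dots> \<le> (\<epsilon> * real N + C) * real m" by (intro mult_right_mono C) simp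
      finally show "real (block_count 2 ?D N (point \<omega>)) / real N
        \<le> real m * \<epsilon> + real m * C / real N" using \<open>1 \<le> N\<close> by (simp add: field_simps)
    qed
  qed
  then show False using m by (simp add: \<epsilon>_def field_simps)
qed

text \<open>The block whose index encodes this base and interval does the work.\<close>

lemma point_hits:
  assumes "t + 1 < 2 ^ h" "b \<ge> 2"
  shows "\<exists>j\<ge>1. real t / 2 ^ h \<le> frac (real b ^ j * point \<omega>) \<and>
           frac (real b ^ j * point \<omega>) \<le> (real t + 1) / 2 ^ h"
proof -
  define k where "k = prod_encode (b - 2, prod_encode (t, h))"
  let ?n = "start k + len k"
  have "hits k ?n (prefix \<omega> ?n)"
    using prefix_in_block[of "len k" k \<omega>] hits_target by simp
  moreover have "b - 2 + 2 = b" using assms by simp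
  ultimately show ?thesis
    using assms(1) point_ge[of \<omega> ?n] point_le[of \<omega> ?n]
    unfolding hits_def k_def by (simp add: prod_encode_inverse)
qed

lemma orbit_dense:
  assumes "b \<ge> 2"
  shows "top_of_set {0..1} closure_of {frac (real b ^ n * point \<omega>) | n :: nat. n \<ge> 1} = {0..1}"
    (is "_ closure_of ?O = _")
proof -
  have "?O \<subseteq> {0..1}" by (auto simp: frac_ge_0 less_imp_le[OF frac_lt_1])
  then have eq: "top_of_set {0..1} closure_of ?O = {0..1} \<inter> closure ?O"
    by (simp add: closure_of_subtopology Int_absorb1)
  have "{0..1} \<subseteq> closure ?O"
  proof
    fix y :: real assume y: "y \<in> {0..1}"
    show "y \<in> closure ?O"
      unfolding closure_approachable
    proof (intro allI impI)
      fix e :: real assume "e > 0"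
      then obtain g where g: "(1/2) ^ g < e" using real_arch_pow_inv[of e "1/2"] by auto
      define h where "h = Suc g"
      have h: "2 / 2 ^ h < e" using g by (simp add: h_def power_divide)
      \<comment> \<open>The cap avoids the excluded interval ending at 1; its price is that
        \<open>y\<close> may lie two steps, not one, beyond \<open>t / 2 ^ h\<close>.\<close>
      define t where "t = min (nat \<lfloor>2 ^ h * y\<rfloor>) (2 ^ h - 2)"
      have h2: "(2::nat) ^ h \<ge> 2" by (simp add: h_def)
      have "t \<le> 2 ^ h - 2" by (simp add: t_def)
      then have t: "t + 1 < 2 ^ h" using h2 by linarith
      have fl: "\<lfloor>2 ^ h * y\<rfloor> \<ge> 0" using y by simp
      have "t \<le> nat \<lfloor>2 ^ h * y\<rfloor>" by (simp add: t_def)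
      then have t1: "real t \<le> 2 ^ h * y"
        using of_nat_floor[of "2 ^ h * y"] y by (meson atLeastAtMost_iff mult_nonneg_nonneg
          of_nat_mono order_trans zero_le_numeral zero_le_power)
      have t2: "2 ^ h * y \<le> real t + 2"
      proof (cases "nat \<lfloor>2 ^ h * y\<rfloor> \<le> 2 ^ h - 2")
        case True
        then have "real t = of_int \<lfloor>2 ^ h * y\<rfloor>" using fl by (simp add: t_def)
        then show ?thesis by linarith
      next
        case False
        then have "real t + 2 = 2 ^ h" using h2 by (simp add: t_def of_nat_diff)
        then show ?thesis using y by simp
      qed
      obtain j where j: "j \<ge> 1" "real t / 2 ^ h \<le> frac (real b ^ j * point \<omega>)"
           "frac (real b ^ j * point \<omega>) \<le> (real t + 1) / 2 ^ h"
        using point_hits[OF t assms] by blast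
      have "real t / 2 ^ h \<le> y" "y \<le> real t / 2 ^ h + 2 / 2 ^ h"
        using t1 t2 by (simp_all add: field_simps)
      moreover have "(real t + 1) / 2 ^ h \<le> real t / 2 ^ h + 2 / 2 ^ h"
        by (simp add: field_simps)
      ultimately have "dist (frac (real b ^ j * point \<omega>)) y < e"
        using j h by (simp add: dist_real_def)
      then show "\<exists>z\<in>?O. dist z y < e" using j(1) by blast
    qed
  qed
  then show ?thesis using eq by blast
qed


section \<open>Topology of the set\<close>

lemma spacing_cong:
  assumes "\<omega> i" "\<And>j. j \<le> i \<Longrightarrow> \<omega> j = \<omega>' j"
  shows "spacing \<omega> = spacing \<omega>'"
proof -
  define r where "r = (LEAST r. \<omega> r)"
  have r: "\<omega> r" "r \<le> i" unfolding r_def using assms(1) by (auto intro: LeastI Least_le)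
  have min: "\<not> \<omega> j" if "j < r" for j using that not_less_Least unfolding r_def by blast
  have "(LEAST r. \<omega>' r) = r"
  proof (rule Least_equality)
    show "\<omega>' r" using r assms(2) by blast
    fix j assume "\<omega>' j"
    then show "r \<le> j" using min[of j] assms(2)[of j] r(2) by (meson leI less_imp_le order_trans)
  qed
  then show ?thesis by (simp add: spacing_def r_def)
qed

text \<open>The spacing affects position \<open>n\<close> only if \<open>\<omega> n\<close> holds,
  and then the first 1 is at or before \<open>n\<close>. This yields continuity of
  \<open>point\<close>.\<close>

lemma prefix_cong:
  assumes "\<And>i. i < n \<Longrightarrow> \<omega> i = \<omega>' i"
  shows "prefix \<omega> n = prefix \<omega>' n"
  using assms
proof (induction n)
  case (Suc n)
  have "(\<omega> n \<and> \<not> spacing \<omega> dvd n) = (\<omega>' n \<and> \<not> spacing \<omega>' dvd n)"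
    using Suc.prems spacing_cong[of \<omega> n \<omega>'] by (metis lessI less_Suc_eq_le)
  then show ?case using Suc by simp
qed simp

lemma dist_point_le:
  assumes "\<And>i. i < n \<Longrightarrow> \<omega> i = \<omega>' i"
  shows "dist (point \<omega>) (point \<omega>') \<le> (1/2) ^ n"
  using point_ge[of \<omega> n] point_le[of \<omega> n] point_ge[of \<omega>' n] point_le[of \<omega>' n]
    prefix_cong[of n \<omega> \<omega>'] assms
  by (simp add: dist_real_def add_divide_distrib power_divide abs_le_iff)

lemma continuous_point: "continuous_on UNIV point"
  unfolding continuous_on_topological
proof (intro ballI allI impI)
  fix \<omega> S assume S: "open S" "point \<omega> \<in> S"
  then obtain e where e: "e > 0" "\<And>y. dist y (point \<omega>) < e \<Longrightarrow> y \<in> S"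
    by (auto simp: open_dist)
  obtain n where n: "(1/2) ^ n < e" using real_arch_pow_inv[of e "1/2"] e(1) by auto
  let ?A = "\<Inter>i\<in>{..<n}. (\<lambda>f. f i) -` {\<omega> i} :: (nat \<Rightarrow> bool) set"
  have "open ?A"
    by (intro open_INT ballI open_vimage continuous_on_product_coordinates open_discrete) simp
  moreover have "\<omega> \<in> ?A" by simp
  moreover have "point f \<in> S" if "f \<in> ?A" for f
    using that dist_point_le[of n f \<omega>] n by (intro e(2)) auto
  ultimately show "\<exists>A. open A \<and> \<omega> \<in> A \<and> (\<forall>f\<in>UNIV. f \<in> A \<longrightarrow> point f \<in> S)" by blast
qed

lemma compact_range_point: "compact (range point)"
proof (rule compact_continuous_image[OF continuous_point])
  have "compact_space (product_topology (\<lambda>i::nat. euclidean :: bool topology) UNIV)"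
    unfolding compact_space_product_topology
    by (simp add: compact_space_def finite_imp_compact)
  then show "compact (UNIV :: (nat \<Rightarrow> bool) set)"
    by (simp add: euclidean_product_topology compact_space_def)
qed

text \<open>One coordinate of the parameter is flipped far out, at a position where the flip shows
  in the digits.\<close>

lemma islimpt_range_point: "point \<omega> islimpt range point"
  unfolding islimpt_approachable
proof (intro allI impI)
  fix e :: real assume "e > 0"
  then obtain n where n: "(1/2) ^ n < e" using real_arch_pow_inv[of e "1/2"] by auto
  define m where "m = spacing \<omega>"
  have m: "m \<ge> 2" using spacing_ge_2 by (simp add: m_def)
  \<comment> \<open>Two adjacent unforced positions suffice, as \<open>m \<ge> 2\<close> cannot
    divide both.\<close>
  obtain i0 where i0: "i0 \<ge> n + m" "{i0..<i0 + 2} \<inter> forced = {}"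
    using exists_unforced_window by blast
  define i where "i = (if m dvd i0 then Suc i0 else i0)"
  have "\<not> m dvd i"
  proof
    assume "m dvd i"
    then have "m dvd i0" "m dvd Suc i0" by (auto simp: i_def split: if_splits)
    then have "m dvd 1" using dvd_diff_nat[of m "Suc i0" i0] by simp
    then show False using m by simp
  qed
  have "i \<in> {i0..<i0 + 2}" by (simp add: i_def)
  then have i: "i \<ge> n + m" "i \<notin> forced" using i0 by auto
  define \<omega>' where "\<omega>' = fun_upd \<omega> i (\<not> \<omega> i)"
  have "digit \<omega> i \<noteq> digit \<omega>' i"
  proof (cases "\<exists>r. \<omega> r")
    case True
    \<comment> \<open>The first 1 lies before \<open>i\<close>, so the flip leaves the spacing
      alone.\<close>
    then have "\<omega> (m - 2)" unfolding m_def spacing_def by (auto intro: LeastI)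
    then have "spacing \<omega> = spacing \<omega>'"
      by (rule spacing_cong) (use i m in \<open>auto simp: \<omega>'_def\<close>)
    then show ?thesis using \<open>\<not> m dvd i\<close> i by (simp add: digit_unforced \<omega>'_def m_def)
  next
    case False
    \<comment> \<open>Here the flip creates the first 1. It survives because \<open>i\<close> is
      positive and less than the new spacing \<open>i + 2\<close>.\<close>
    then have "(LEAST r. \<omega>' r) = i" by (intro Least_equality) (auto simp: \<omega>'_def split: if_splits)
    then have sp: "spacing \<omega>' = i + 2" by (simp add: spacing_def)
    have "\<not> spacing \<omega>' dvd i"
      unfolding sp using i m by (intro nat_dvd_not_less) auto
    then show ?thesis using False i by (simp add: digit_unforced \<omega>'_def)
  qed
  then have "point \<omega>' \<noteq> point \<omega>" using base_digits_point by metis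
  moreover have "dist (point \<omega>') (point \<omega>) < e"
    using dist_point_le[of n \<omega>' \<omega>] n i by (auto simp: \<omega>'_def)
  ultimately show "\<exists>x'\<in>range point. x' \<noteq> point \<omega> \<and> dist x' (point \<omega>) < e" by blast
qed

text \<open>The orbit of a fraction with denominator \<open>b\<close> stays among the finitely many
  \<open>k / b\<close>; a finite set is closed and cannot be dense.\<close>

lemma point_irrational: "point \<omega> \<notin> \<rat>"
proof
  assume "point \<omega> \<in> \<rat>"
  then obtain a b where ab: "b > 0" "point \<omega> = of_int a / of_int b"
    by (auto elim!: Rats_cases')
  let ?O = "{frac (real 2 ^ n * point \<omega>) | n :: nat. n \<ge> 1}"
  have "?O \<subseteq> (\<lambda>k. of_int k / of_int b) ` {0..<b}"
  proof safe
    fix n :: nat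
    have "frac (real 2 ^ n * point \<omega>) = of_int (2 ^ n * a mod b) / of_int b"
    proof -
      have eq: "real 2 ^ n * point \<omega> = of_int (2 ^ n * a) / of_int b" using ab by simp
      have "real_of_int (2 ^ n * a) = of_int (b * (2 ^ n * a div b) + 2 ^ n * a mod b)" by simp
      then have "real_of_int (2 ^ n * a) / of_int b
          = of_int (2 ^ n * a div b) + of_int (2 ^ n * a mod b) / of_int b"
        using ab(1) unfolding of_int_add of_int_mult by (simp add: add_divide_distrib)
      then show ?thesis unfolding eq frac_def floor_divide_of_int_eq by simp
    qed
    then show "frac (real 2 ^ n * point \<omega>) \<in> (\<lambda>k. of_int k / of_int b) ` {0..<b}"
      using ab by auto
  qed
  then have "finite ?O" by (rule finite_subset) simp
  then have "closure ?O = ?O" by (simp add: finite_imp_closed)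
  moreover have "{0..1} \<subseteq> closure ?O"
    using orbit_dense[of 2 \<omega>] by (auto simp: closure_of_subtopology dest: closure_mono[THEN subsetD, rotated])
  ultimately have "{0..1} \<subseteq> ?O" by argo
  from finite_subset[OF this \<open>finite ?O\<close>] have "finite {0..1::real}" .
  then show False using infinite_Icc[of "0::real" 1] by simp
qed

text \<open>A connected set of reals with two points contains the interval between them, hence a
  rational.\<close>

lemma connected_component_irrational:
  fixes A :: "real set"
  assumes "A \<inter> \<rat> = {}" "x \<in> A"
  shows "connected_component_set A x = {x}"
proof -
  have "y = x" if "connected_component A x y" for y
  proof (rule ccontr)
    assume "y \<noteq> x"
    obtain T where T: "connected T" "T \<subseteq> A" "x \<in> T" "y \<in> T"
      using \<open>connected_component A x y\<close> by (auto simp: connected_component_def)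
    have "min x y < max x y" using \<open>y \<noteq> x\<close> by simp
    then obtain q where "q \<in> \<rat>" "min x y < q" "q < max x y"
      using Rats_dense_in_real by blast
    moreover have "{min x y..max x y} \<subseteq> T"
      using T connected_contains_Icc[of T x y] connected_contains_Icc[of T y x]
      by (simp add: min_def max_def)
    moreover have "q \<in> {min x y..max x y}"
      using \<open>min x y < q\<close> \<open>q < max x y\<close> by simp
    ultimately show False using T(2) assms(1) by blast
  qed
  then show ?thesis using assms(2) by (auto simp: connected_component_refl)
qed

lemma cantor_set_range_point: "cantor_set (range point)"
  unfolding cantor_set_def
  using compact_range_point islimpt_range_point point_irrational
  by (auto intro!: connected_component_irrational)

section \<open>Hausdorff dimension\<close>

text \<open>The first \<open>m\<close> positions are set aside for fixing the spacing.\<close>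

definition free :: "nat \<Rightarrow> nat set" where
  "free m = {i. m \<le> i \<and> i \<notin> forced \<and> \<not> m dvd i}"

definition free_count :: "nat \<Rightarrow> nat \<Rightarrow> nat" where
  "free_count m n = card (free m \<inter> {..<n})"

text \<open>The 1 at position \<open>m - 2\<close> makes the spacing equal to \<open>m\<close>.\<close>

definition code :: "nat \<Rightarrow> real \<Rightarrow> nat \<Rightarrow> bool" where
  "code m u i \<longleftrightarrow> i = m - 2 \<or> m \<le> i \<and> odd \<lfloor>2 ^ Suc (free_count m i) * u\<rfloor>"

lemma free_count_Suc: "free_count m (Suc n) = free_count m n + of_bool (n \<in> free m)"
  by (auto simp: free_count_def lessThan_Suc Int_insert_right)

lemma spacing_code: "m \<ge> 2 \<Longrightarrow> spacing (code m u) = m"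
proof -
  assume m: "m \<ge> 2"
  have "(LEAST i. code m u i) = m - 2" by (rule Least_equality) (auto simp: code_def)
  then show ?thesis using m by (simp add: spacing_def)
qed

lemma digit_code:
  assumes "m \<ge> 2" "i \<in> free m"
  shows "digit (code m u) i = of_bool (odd \<lfloor>2 ^ Suc (free_count m i) * u\<rfloor>)"
  using assms by (subst digit_unforced) (auto simp: free_def spacing_code code_def)

text \<open>Each free position reveals the next binary digit of the parameter, so \<open>n\<close>
  digits of the point fix its first \<open>free_count m n\<close> digits.\<close>

lemma prefix_code_determines:
  assumes "m \<ge> 2" "u \<in> {0..<1}" "v \<in> {0..<1}" "prefix (code m u) n = prefix (code m v) n"
  shows "\<lfloor>2 ^ free_count m n * u\<rfloor> = \<lfloor>2 ^ free_count m n * v\<rfloor>"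
  using assms(4)
proof (induction n)
  case 0
  have "\<lfloor>u\<rfloor> = 0" "\<lfloor>v\<rfloor> = 0" using assms by (auto simp: floor_eq_iff)
  then show ?case by (simp add: free_count_def)
next
  case (Suc n)
  have pre: "prefix (code m u) n = prefix (code m v) n" using Suc.prems prefix_Suc_div by metis
  show ?case
  proof (cases "n \<in> free m")
    case True
    have "digit (code m u) n = digit (code m v) n" using Suc.prems by (simp add: digit_def)
    then have "odd \<lfloor>2 ^ Suc (free_count m n) * u\<rfloor> = odd \<lfloor>2 ^ Suc (free_count m n) * v\<rfloor>"
      unfolding digit_code[OF assms(1) True] of_bool_eq_iff .
    then have "\<lfloor>2 ^ Suc (free_count m n) * u\<rfloor> mod 2 = \<lfloor>2 ^ Suc (free_count m n) * v\<rfloor> mod 2"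
      unfolding mod2_eq_if by metis
    moreover have "\<lfloor>2 ^ Suc r * y\<rfloor> = 2 * \<lfloor>2 ^ r * y\<rfloor> + \<lfloor>2 ^ Suc r * y\<rfloor> mod 2" for r and y :: real
      using floor_mult_base[of 2 "2 ^ r * y"] by (simp add: mult.assoc)
    ultimately have "\<lfloor>2 ^ Suc (free_count m n) * u\<rfloor> = \<lfloor>2 ^ Suc (free_count m n) * v\<rfloor>"
      using Suc.IH[OF pre] by metis
    then show ?thesis using True by (simp add: free_count_Suc)
  next
    case False
    then show ?thesis using Suc.IH[OF pre] by (simp add: free_count_Suc)
  qed
qed

lemma card_multiples_le:
  assumes "m > 0"
  shows "real (card {i. i < n \<and> m dvd i}) \<le> real n / real m + 1"
proof -
  have "{i. i < n \<and> m dvd i} \<subseteq> (*) m ` {..n div m}"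
  proof
    fix i assume i: "i \<in> {i. i < n \<and> m dvd i}"
    then have "i = m * (i div m)" "i div m \<le> n div m" by (auto intro: div_le_mono)
    then show "i \<in> (*) m ` {..n div m}" by blast
  qed
  from surj_card_le[OF _ this] have "card {i. i < n \<and> m dvd i} \<le> n div m + 1" by simp
  moreover have "real (n div m) \<le> real n / real m" by (rule of_nat_div_le_of_nat)
  ultimately show ?thesis by linarith
qed

lemma free_count_lower_bound:
  fixes s :: real
  assumes "s < 1"
  shows "\<exists>m\<ge>2. \<exists>C\<ge>0. \<forall>n. s * real n - C \<le> real (free_count m n)"
proof -
  \<comment> \<open>One \<open>\<epsilon>\<close> pays for the forced positions, the other for the
    multiples of \<open>m\<close>.\<close>
  define \<epsilon> where "\<epsilon> = (1 - s) / 2"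
  have e: "\<epsilon> > 0" using assms by (simp add: \<epsilon>_def)
  obtain m0 :: nat where m0: "1 / \<epsilon> < real m0" using reals_Archimedean2 by blast
  define m where "m = m0 + 2"
  have m: "m \<ge> 2" "1 / real m \<le> \<epsilon>" using m0 e by (auto simp: m_def field_simps)
  obtain C where C: "C \<ge> 0" "\<And>n. real (card (forced \<inter> {..<n})) \<le> \<epsilon> * real n + C"
    using card_forced_le[OF e] by blast
  have "s * real n - (C + 1 + real m) \<le> real (free_count m n)" for n
  proof -
    have "{..<n} \<subseteq> free m \<inter> {..<n} \<union> (forced \<inter> {..<n} \<union> ({i. i < n \<and> m dvd i} \<union> {..<m}))"
      by (auto simp: free_def)
    then have "card {..<n} \<le> card (free m \<inter> {..<n} \<union> (forced \<inter> {..<n} \<union> ({i. i < n \<and> m dvd i} \<union> {..<m})))"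
      by (intro card_mono) auto
    also have "\<dots> \<le> free_count m n + (card (forced \<inter> {..<n}) + (card {i. i < n \<and> m dvd i} + card {..<m}))"
      unfolding free_count_def by (intro card_Un_le[THEN order_trans] add_left_mono) simp
    finally have "real n \<le> real (free_count m n) + real (card (forced \<inter> {..<n}))
        + real (card {i. i < n \<and> m dvd i}) + real m"
      by simp
    also have "\<dots> \<le> real (free_count m n) + (\<epsilon> * real n + C) + (real n / real m + 1) + real m"
      using C(2)[of n] card_multiples_le[of m n] m by simp
    also have "real n / real m \<le> \<epsilon> * real n"
      using mult_right_mono[OF m(2), of "real n"] by simp
    finally show ?thesis by (simp add: \<epsilon>_def algebra_simps)
  qed
  moreover have "C + 1 + real m \<ge> 0" using C by simp
  ultimately show ?thesis using m by blast
qed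

text \<open>Points at distance at most \<open>1 / 2 ^ n\<close> share only five possible prefixes of
  length \<open>n\<close>, and each prefix confines the parameter to one dyadic interval.\<close>

lemma cover_preimage:
  fixes U :: "real set"
  assumes m: "m \<ge> 2" and U: "bounded U" "diameter U \<le> 1 / 2 ^ n"
  shows "\<exists>V\<in>sets lborel. {u \<in> {0..<1}. point (code m u) \<in> U} \<subseteq> V \<and>
           emeasure lborel V \<le> ennreal (5 / 2 ^ free_count m n)"
proof (cases "{u \<in> {0..<1}. point (code m u) \<in> U} = {}")
  case True
  then show ?thesis by (intro bexI[of _ "{}"]) auto
next
  case False
  then obtain u0 where u0: "u0 \<in> {0..<1}" "point (code m u0) \<in> U" by auto
  define r where "r = free_count m n"
  define P where "P = (\<lambda>u. prefix (code m u) n)"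
  define c where "c = (\<lambda>q. \<lfloor>2 ^ r * (SOME u. u \<in> {0..<1} \<and> P u = q)\<rfloor>)"
  \<comment> \<open>By \<open>prefix_code_determines\<close> the choice of \<open>u\<close> in \<open>c\<close> does not matter.\<close>
  define W where "W = (\<lambda>q. {of_int (c q) / 2 ^ r ..< (of_int (c q) + 1) / 2 ^ r :: real})"
  \<comment> \<open>On the scale \<open>2 ^ n\<close> the points are at most 1 apart and each
    exceeds its prefix by at most 1, so prefixes differ by at most 2. Truncated subtraction can only
    shorten the range.\<close>
  define Q where "Q = {P u0 - 2..P u0 + 2}"
  have "{u \<in> {0..<1}. point (code m u) \<in> U} \<subseteq> (\<Union>q\<in>Q. W q)"
  proof safe
    fix u :: real assume u: "u \<in> {0..<1}" "point (code m u) \<in> U"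
    have "dist (point (code m u)) (point (code m u0)) \<le> 1 / 2 ^ n"
      using diameter_bounded_bound[OF U(1) u(2) u0(2)] U(2) by simp
    then have "\<bar>point (code m u) - point (code m u0)\<bar> * 2 ^ n \<le> 1"
      by (simp add: dist_real_def field_simps)
    moreover have "\<bar>point (code m u) - point (code m u0)\<bar> * 2 ^ n
        = \<bar>2 ^ n * point (code m u) - 2 ^ n * point (code m u0)\<bar>"
      by (simp only: right_diff_distrib[symmetric] abs_mult) simp
    moreover have "real (P v) \<le> 2 ^ n * point (code m v)" "2 ^ n * point (code m v) \<le> real (P v) + 1" for v
      using point_ge[of "code m v" n] point_le[of "code m v" n]
      by (simp_all add: P_def field_simps)
    note this[of u] this[of u0]
    ultimately have "P u \<in> Q" unfolding Q_def by (auto simp: abs_le_iff)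
    define v where "v = (SOME v. v \<in> {0..<1} \<and> P v = P u)"
    have v: "v \<in> {0..<1} \<and> P v = P u" unfolding v_def by (rule someI[of _ u]) (use u in auto)
    have "c (P u) = \<lfloor>2 ^ r * v\<rfloor>" unfolding c_def v_def ..
    then have floor: "\<lfloor>2 ^ r * u\<rfloor> = c (P u)"
      using prefix_code_determines[OF m u(1), of v n] v unfolding r_def P_def by metis
    have "of_int (c (P u)) \<le> 2 ^ r * u" "2 ^ r * u < of_int (c (P u)) + 1"
      using floor_correct[of "2 ^ r * u"] unfolding floor by simp_all
    then have "u \<in> W (P u)"
      by (simp add: W_def pos_divide_le_eq pos_less_divide_eq mult.commute)
    then show "u \<in> (\<Union>q\<in>Q. W q)" using \<open>P u \<in> Q\<close> by blast
  qed
  moreover have "emeasure lborel (\<Union>q\<in>Q. W q) \<le> ennreal (5 / 2 ^ r)"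
  proof -
    have "emeasure lborel (W q) = ennreal (1 / 2 ^ r)" for q
      unfolding W_def by (subst emeasure_lborel_Ico) (auto simp: field_simps)
    moreover have "emeasure lborel (\<Union>q\<in>Q. W q) \<le> (\<Sum>q\<in>Q. emeasure lborel (W q))"
      by (rule emeasure_subadditive_finite) (auto simp: Q_def W_def)
    ultimately have "emeasure lborel (\<Union>q\<in>Q. W q) \<le> (\<Sum>q\<in>Q. ennreal (1 / 2 ^ r))"
      by simp
    also have "\<dots> = ennreal (real (card Q) / 2 ^ r)"
      by (subst sum_ennreal) auto
    also have "\<dots> \<le> ennreal (5 / 2 ^ r)"
      by (intro ennreal_leI divide_right_mono) (auto simp: Q_def)
    finally show ?thesis .
  qed
  moreover have "(\<Union>q\<in>Q. W q) \<in> sets lborel" by (auto simp: Q_def W_def)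
  ultimately show ?thesis unfolding r_def by blast
qed

text \<open>Passes from dyadic scales to diameters: 5 counts the intervals, \<open>2 powr C\<close>
  pays for the lost digits, \<open>2 powr s\<close> for rounding the diameter up to a power of
  1/2.\<close>

lemma cover_preimage_diam_power:
  fixes U :: "real set"
  assumes m: "m \<ge> 2" and C: "C \<ge> 0" "\<And>n. s * real n - C \<le> real (free_count m n)"
    and s: "s \<ge> 0" and U: "bounded U" "diameter U \<le> 1"
  shows "\<exists>V\<in>sets lborel. {u \<in> {0..<1}. point (code m u) \<in> U} \<subseteq> V \<and>
           emeasure lborel V \<le> ennreal (5 * 2 powr C * 2 powr s) * diam_power s U"
proof -
  let ?K = "5 * 2 powr C * 2 powr s"
  have bound: "5 / 2 ^ free_count m n \<le> 5 * 2 powr C * (1 / 2 ^ n) powr s" for n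
  proof -
    have "5 / 2 ^ free_count m n = 5 * 2 powr (- real (free_count m n))"
      by (simp add: powr_minus powr_realpow divide_inverse)
    also have "\<dots> \<le> 5 * 2 powr (C - s * real n)"
      using C(2)[of n] by (intro mult_left_mono powr_mono) auto
    also have "2 powr (C - s * real n) = 2 powr C * (1 / 2 ^ n) powr s"
      by (simp add: powr_diff powr_divide powr_powr mult.commute flip: powr_realpow)
    finally show ?thesis by (simp add: mult.assoc)
  qed
  consider "U = {}" | "U \<noteq> {}" "s = 0" | "U \<noteq> {}" "s > 0" "diameter U = 0"
    | "U \<noteq> {}" "s > 0" "diameter U > 0"
    using s diameter_ge_0[OF U(1)] by fastforce
  then show ?thesis
  proof cases
    case 1
    then show ?thesis by (intro bexI[of _ "{}"]) auto
  next
    \<comment> \<open>Every nonempty set has weight 1 here, so all of \<open>{0..<1}\<close> may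
      serve as \<open>V\<close>.\<close>
    case 2
    have "1 \<le> (2::real) powr C" using C by (intro ge_one_powr_ge_zero) auto
    then have "ennreal 1 \<le> ennreal ?K" using 2 by (intro ennreal_leI) simp
    then show ?thesis using 2 by (intro bexI[of _ "{0..<1}"]) (auto simp: diam_power_def)
  next
    \<comment> \<open>The weight is 0, so a null set is required: the covers for all
      \<open>n\<close> are intersected.\<close>
    case 3
    have "\<forall>n. \<exists>V. V \<in> sets lborel \<and> {u \<in> {0..<1}. point (code m u) \<in> U} \<subseteq> V \<and>
           emeasure lborel V \<le> ennreal (5 / 2 ^ free_count m n)"
      using cover_preimage[OF m U(1)] 3(3) by (simp add: Bex_def)
    note choice[OF this]
    then obtain V where V: "\<And>n. V n \<in> sets lborel"
      "\<And>n. {u \<in> {0..<1}. point (code m u) \<in> U} \<subseteq> V n"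
      "\<And>n. emeasure lborel (V n) \<le> ennreal (5 / 2 ^ free_count m n)"
      by blast
    have "emeasure lborel (\<Inter>n. V n) \<le> ennreal (5 * 2 powr C * (1 / 2 ^ n) powr s)" for n
    proof -
      have "emeasure lborel (\<Inter>n. V n) \<le> emeasure lborel (V n)"
        using V(1) by (intro emeasure_mono) auto
      also note V(3)[of n]
      also have "ennreal (5 / 2 ^ free_count m n) \<le> ennreal (5 * 2 powr C * (1 / 2 ^ n) powr s)"
        by (intro ennreal_leI bound)
      finally show ?thesis .
    qed
    moreover have "(\<lambda>n. ennreal (5 * 2 powr C * (1 / 2 ^ n) powr s)) \<longlonglongrightarrow> ennreal 0"
      by (intro tendsto_ennrealI) (use 3 in real_asymp)
    ultimately have "emeasure lborel (\<Inter>n. V n) \<le> ennreal 0"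
      by (intro LIMSEQ_le_const[where X = "\<lambda>n. ennreal (5 * 2 powr C * (1 / 2 ^ n) powr s)"]) auto
    then have "emeasure lborel (\<Inter>n. V n) \<le> ennreal ?K * diam_power s U" by simp
    moreover have "(\<Inter>n. V n) \<in> sets lborel" using V(1) by auto
    ultimately show ?thesis using V(2) by (intro bexI[of _ "\<Inter>n. V n"]) auto
  next
    case 4
    \<comment> \<open>Places the diameter above \<open>(1/2) ^ N\<close> and at most
      \<open>(1/2) ^ (N - 1)\<close>.\<close>
    define N where "N = (LEAST n. (1/2) ^ n < diameter U)"
    obtain n0 where n0: "(1/2) ^ n0 < diameter U"
      using real_arch_pow_inv[of "diameter U" "1/2"] 4 by auto
    have N: "(1/2) ^ N < diameter U" unfolding N_def using n0 by (rule LeastI)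
    then have "N \<noteq> 0" using U by (intro notI) simp
    then obtain n where n: "N = Suc n" by (cases N) auto
    have "diameter U \<le> 1 / 2 ^ n"
      using not_less_Least[of n "\<lambda>n. (1/2) ^ n < diameter U"] n
      unfolding N_def by (simp add: power_divide)
    from cover_preimage[OF m U(1) this] obtain V where V: "V \<in> sets lborel"
      "{u \<in> {0..<1}. point (code m u) \<in> U} \<subseteq> V"
      "emeasure lborel V \<le> ennreal (5 / 2 ^ free_count m n)" by blast
    have "(1 / 2 ^ n) powr s \<le> (2 * diameter U) powr s"
      using N n s by (intro powr_mono2) (auto simp: power_divide)
    also have "\<dots> = 2 powr s * diameter U powr s" using 4 by (simp add: powr_mult)
    finally have "5 * 2 powr C * (1 / 2 ^ n) powr s \<le> 5 * 2 powr C * (2 powr s * diameter U powr s)"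
      by (intro mult_left_mono) auto
    then have "5 / 2 ^ free_count m n \<le> ?K * diameter U powr s" using order_trans[OF bound[of n]] by (simp add: mult.assoc)
    then have "ennreal (5 / 2 ^ free_count m n) \<le> ennreal ?K * diam_power s U"
      using 4 by (simp add: diam_power_def flip: ennreal_mult)
    then show ?thesis using V order_trans by blast
  qed
qed

text \<open>A mass distribution argument: a cover of the set pulls back under \<open>code m\<close>
  to a cover of \<open>{0..<1}\<close>, of Lebesgue measure 1. The scale 1 suffices because the
  measure is a supremum over scales.\<close>

lemma hausdorff_measure_point_nonzero:
  assumes "0 \<le> s" "s < 1"
  shows "hausdorff_measure s (range point) \<noteq> 0"
proof -
  obtain m C where m: "m \<ge> 2" and C: "C \<ge> 0" "\<And>n. s * real n - C \<le> real (free_count m n)"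
    using free_count_lower_bound[OF assms(2)] by blast
  define K where "K = 5 * 2 powr C * 2 powr s"
  have K: "K > 0" by (simp add: K_def)
  have "ennreal (1 / K) \<le> hausdorff_premeasure 1 s (range point)"
    unfolding hausdorff_premeasure_def
  proof (rule INF_greatest)
    fix U :: "nat \<Rightarrow> real set"
    assume "U \<in> {U. range point \<subseteq> (\<Union>i. U i) \<and> (\<forall>i. bounded (U i) \<and> diameter (U i) \<le> 1)}"
    then have U: "range point \<subseteq> (\<Union>i. U i)" "\<And>i. bounded (U i)" "\<And>i. diameter (U i) \<le> 1"
      by auto
    have "\<forall>i. \<exists>V. V \<in> sets lborel \<and> {u \<in> {0..<1}. point (code m u) \<in> U i} \<subseteq> V \<and>
           emeasure lborel V \<le> ennreal K * diam_power s (U i)"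
      using cover_preimage_diam_power[OF m C assms(1) U(2,3)] unfolding K_def Bex_def by blast
    note choice[OF this]
    then obtain V where V: "\<And>i. V i \<in> sets lborel"
      "\<And>i. {u \<in> {0..<1}. point (code m u) \<in> U i} \<subseteq> V i"
      "\<And>i. emeasure lborel (V i) \<le> ennreal K * diam_power s (U i)"
      by blast
    have "{0..<1} \<subseteq> (\<Union>i. V i)"
    proof
      fix u :: real assume u: "u \<in> {0..<1}"
      obtain i where "point (code m u) \<in> U i" using U(1) by blast
      then show "u \<in> (\<Union>i. V i)" using V(2)[of i] u by blast
    qed
    then have "emeasure lborel {0..<1::real} \<le> emeasure lborel (\<Union>i. V i)"
      using V(1) by (intro emeasure_mono) auto
    also have "\<dots> \<le> (\<Sum>i. emeasure lborel (V i))"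
      using V(1) by (intro emeasure_subadditive_countably) auto
    also have "\<dots> \<le> (\<Sum>i. ennreal K * diam_power s (U i))"
      by (intro suminf_le V(3) summableI)
    also have "\<dots> = ennreal K * (\<Sum>i. diam_power s (U i))" by simp
    finally have "1 \<le> ennreal K * (\<Sum>i. diam_power s (U i))" by simp
    then have "ennreal (1 / K) * 1 \<le> ennreal (1 / K) * (ennreal K * (\<Sum>i. diam_power s (U i)))"
      by (rule mult_left_mono) simp
    then show "ennreal (1 / K) \<le> (\<Sum>i. diam_power s (U i))"
      using K by (simp flip: mult.assoc ennreal_mult)
  qed
  also have "\<dots> \<le> hausdorff_measure s (range point)"
    unfolding hausdorff_measure_def by (rule SUP_upper) simp
  finally show ?thesis using K by (auto simp: ennreal_eq_0_iff)
qed

text \<open>Cutting the unit interval into \<open>n\<close> equal pieces gives the sum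
  \<open>n * (1 / n) powr s\<close>, which tends to 0.\<close>

lemma hausdorff_measure_unit_interval_zero:
  assumes "E \<subseteq> {0..1::real}" "s > 1"
  shows "hausdorff_measure s E = 0"
proof -
  have "hausdorff_premeasure \<delta> s E = 0" if "\<delta> > 0" for \<delta>
  proof -
    have le: "hausdorff_premeasure \<delta> s E \<le> ennreal (real n * (1 / real n) powr s)"
      if n: "n \<ge> 1" "1 / real n \<le> \<delta>" for n
    proof -
      define U where "U = (\<lambda>i. if i < n then {real i / real n..(real i + 1) / real n} else {})"
      have diam: "diameter (U i) = (if i < n then 1 / real n else 0)" for i
      proof -
        have "real i / real n \<le> (real i + 1) / real n" by (simp add: divide_right_mono)
        then show ?thesis
          by (simp add: U_def diameter_closed_interval flip: diff_divide_distrib)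
      qed
      have "E \<subseteq> (\<Union>i. U i)"
      proof
        fix x assume "x \<in> E"
        then have x: "0 \<le> x" "x \<le> 1" using assms by auto
        \<comment> \<open>The cap puts \<open>x = 1\<close> into the last piece.\<close>
        define i where "i = min (nat \<lfloor>real n * x\<rfloor>) (n - 1)"
        have i: "i < n" using n by (auto simp: i_def)
        have fl: "\<lfloor>real n * x\<rfloor> \<ge> 0" using x by simp
        have "i \<le> nat \<lfloor>real n * x\<rfloor>" by (simp add: i_def)
        then have i1: "real i \<le> real n * x"
          using of_nat_floor[of "real n * x"] x by (meson mult_nonneg_nonneg of_nat_0_le_iff
            of_nat_mono order_trans)
        have i2: "real n * x \<le> real i + 1"
        proof (cases "nat \<lfloor>real n * x\<rfloor> \<le> n - 1")
          case True
          then have "real i = of_int \<lfloor>real n * x\<rfloor>" using fl by (simp add: i_def)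
          then show ?thesis by linarith
        next
          case False
          then have "real i + 1 = real n" using n by (simp add: i_def of_nat_diff)
          then show ?thesis using x by (simp add: mult_left_le)
        qed
        have "x \<in> U i" using i i1 i2 n by (simp add: U_def field_simps)
        then show "x \<in> (\<Union>i. U i)" by blast
      qed
      moreover have "bounded (U i)" "diameter (U i) \<le> \<delta>" for i
        using n \<open>\<delta> > 0\<close> by (simp_all add: diam) (simp add: U_def)
      ultimately have "hausdorff_premeasure \<delta> s E \<le> (\<Sum>i. diam_power s (U i))"
        unfolding hausdorff_premeasure_def by (intro INF_lower) auto
      also have "\<dots> = (\<Sum>i<n. diam_power s (U i))"
        by (rule suminf_finite) (auto simp: U_def diam_power_def)
      also have "\<dots> = (\<Sum>i<n. ennreal ((1 / real n) powr s))"
        using assms by (intro sum.cong) (auto simp: diam_power_def diam, auto simp: U_def divide_right_mono)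
      also have "\<dots> = ennreal (real n * (1 / real n) powr s)"
        by (subst sum_ennreal) auto
      finally show ?thesis .
    qed
    have "(\<lambda>n. ennreal (real n * (1 / real n) powr s)) \<longlonglongrightarrow> ennreal 0"
      by (intro tendsto_ennrealI) (use assms in real_asymp)
    moreover have "\<forall>\<^sub>F n in sequentially. n \<ge> 1 \<and> 1 / real n \<le> \<delta>"
      using \<open>\<delta> > 0\<close> by (intro eventually_conj) real_asymp+
    then have "\<forall>\<^sub>F n in sequentially. hausdorff_premeasure \<delta> s E \<le> ennreal (real n * (1 / real n) powr s)"
      by eventually_elim (use le in auto)
    ultimately have "hausdorff_premeasure \<delta> s E \<le> ennreal 0"
      by (rule tendsto_lowerbound) simp
    then show ?thesis by simp
  qed
  then have "hausdorff_measure s E \<le> 0"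
    unfolding hausdorff_measure_def by (intro SUP_least) simp
  then show ?thesis by simp
qed

lemma hausdorff_dim_range_point: "hausdorff_dim (range point) = 1"
proof (rule antisym)
  show "hausdorff_dim (range point) \<le> 1"
  proof (rule ennreal_le_epsilon)
    fix e :: real assume "e > 0"
    then have "hausdorff_measure (1 + e) (range point) = 0"
      using point_range by (intro hausdorff_measure_unit_interval_zero) (auto simp: less_imp_le)
    then have "hausdorff_dim (range point) \<le> ennreal (1 + e)"
      unfolding hausdorff_dim_def using \<open>e > 0\<close> by (intro Inf_lower CollectI exI[of _ "1 + e"]) simp
    then show "hausdorff_dim (range point) \<le> 1 + ennreal e"
      using \<open>e > 0\<close> by (simp add: ennreal_plus)
  qed
  show "1 \<le> hausdorff_dim (range point)"
    unfolding hausdorff_dim_def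
  proof (rule Inf_greatest, clarify)
    fix s :: real assume "s \<ge> 0" "hausdorff_measure s (range point) = 0"
    then have "s \<ge> 1" using hausdorff_measure_point_nonzero by force
    then show "1 \<le> ennreal s" by (simp add: ennreal_ge_1)
  qed
qed

theorem theorem1:
  shows "\<exists>E :: real set.
    E \<subseteq> {0..1} \<and> cantor_set E \<and>
    (\<forall>x\<in>E. \<not> normal_number 2 x) \<and>
    (\<forall>x\<in>E.
       top_of_set {0..1} closure_of {frac (2 ^ n * x) | n :: nat. n \<ge> 1} = {0..1} \<and>
       top_of_set {0..1} closure_of {frac (3 ^ n * x) | n :: nat. n \<ge> 1} = {0..1}) \<and>
    hausdorff_dim E = 1"
proof (intro exI conjI ballI)
  show "range point \<subseteq> {0..1}" using point_range by (auto simp: less_imp_le)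
  show "cantor_set (range point)" by (rule cantor_set_range_point)
  show "hausdorff_dim (range point) = 1" by (rule hausdorff_dim_range_point)
  fix x assume "x \<in> range point"
  then obtain \<omega> where x: "x = point \<omega>" by blast
  show "\<not> normal_number 2 x" unfolding x by (rule point_not_normal)
  show "top_of_set {0..1} closure_of {frac (2 ^ n * x) | n :: nat. n \<ge> 1} = {0..1}"
    unfolding x using orbit_dense[of 2 \<omega>] by simp
  show "top_of_set {0..1} closure_of {frac (3 ^ n * x) | n :: nat. n \<ge> 1} = {0..1}"
    unfolding x using orbit_dense[of 3 \<omega>] by simp
qed

end
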